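(* Let $a,b:\mathbb{R}\to\mathbb{R}$ be continuous, let $\mathcal{X}\subseteq\mathbb{R}$ be a compact set containing the origin, and let $\underline b>0$ be such that $|b(x)|\ge \underline b$ for all $x\in\mathcal{X}$. Let $L>0$ be such that $|a(x)|\le L$ for all $x\in\mathcal{X}$, and put $\bar\gamma := 1+L^2/\underline b^2$. Let $\bar r$ be the largest value of $r>0$ such that $B_r:=\{x\in\mathbb{R}:|x|\le r\}\subseteq\mathcal{X}$, and let $B_\delta:=\{x\in\mathbb{R}:|x|\le\delta\}$ with $\delta:=\bar\gamma^{-1/2}\,\bar r$. Consider the closed-loop system $$x_{t+1}=(a(x_t)+b(x_t)k(x_t))\,x_t,\qquad t\in\mathbb{N}_0,$$ where, for each $t$, $(k(x_t),p(x_t),\ell(x_t),\gamma(x_t))$ is the unique optimal solution of the program $\mathrm{SDP}(x)$ (defined in the context) with $x=x_t$. Then any solution of the closed-loop system with $x_0\in B_\delta$ converges geometrically to the origin. Moreover, defining $\tilde p(x_0)=p(x_0)$, $\tilde p(x_t)=\max\{p(x_t),\tilde p(x_{t-1})\}$ for $t\ge1$, and $V_t(x_t)=\tilde p(x_t)^{-1}x_t^2$, the function $V_t$ is a Lyapunov function certifying stability in the sense that $$V_t(x_t)\le (1-\bar\gamma^{-1})^t\,V_0(x_0)\qquad\text{for all } t\in\mathbb{N}_0.$$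
   Context: For $x\in\mathbb{R}$, $\mathrm{SDP}(x)$ is the following optimization problem in the real decision variables $(k,p,\ell,\gamma)$ (whose optimal values are denoted $k(x),p(x),\ell(x),\gamma(x)$): minimize $\gamma$ subject to - $(a(x)+b(x)k)^2p-p+1\le 0$, - $p\ge 1$, - $\ell-p\,k^2\ge 0$, - $\gamma\ge p+\ell$. Whenever $b(x)\ne0$ this problem has a unique optimal solution. The quantity $\tilde p(x_t)$ is defined recursively along the trajectory (so it depends on $x_0,\dots,x_t$). "Converges geometrically to the origin" means that there exist constants $C>0$ and $\rho\in[0,1)$ such that $|x_t|\le C\rho^t|x_0|$ for all $t\in\mathbb{N}_0$. $\mathbb{N}_0$ denotes the natural numbers including zero. *)

theory Defs
  imports "HOL-Analysis.Analysis"
begin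

text \<open>The decision variable of the program is the quadruple \<open>(k, p, l, \<gamma>)\<close>.\<close>

definition sdp_feasible ::
  "(real \<Rightarrow> real) \<Rightarrow> (real \<Rightarrow> real) \<Rightarrow> real \<Rightarrow> real \<times> real \<times> real \<times> real \<Rightarrow> bool" where
  "sdp_feasible a b x = (\<lambda>(k, p, l, \<gamma>).
     (a x + b x * k)\<^sup>2 * p - p + 1 \<le> 0 \<and> p \<ge> 1 \<and> l - p * k\<^sup>2 \<ge> 0 \<and> \<gamma> \<ge> p + l)"

definition sdp_optimal ::
  "(real \<Rightarrow> real) \<Rightarrow> (real \<Rightarrow> real) \<Rightarrow> real \<Rightarrow> real \<times> real \<times> real \<times> real \<Rightarrow> bool" where
  "sdp_optimal a b x = is_arg_min (\<lambda>(k, p, l, \<gamma>). \<gamma>) (sdp_feasible a b x)"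

text \<open>
  The optimal solution exists and is unique whenever \<open>b x \<noteq> 0\<close>; where there is no unique
  optimal solution the value below is unspecified.
\<close>

definition sdp_solution ::
  "(real \<Rightarrow> real) \<Rightarrow> (real \<Rightarrow> real) \<Rightarrow> real \<Rightarrow> real \<times> real \<times> real \<times> real" where
  "sdp_solution a b x = (THE z. sdp_optimal a b x z)"

definition k_opt :: "(real \<Rightarrow> real) \<Rightarrow> (real \<Rightarrow> real) \<Rightarrow> real \<Rightarrow> real" where
  "k_opt a b x = (case sdp_solution a b x of (k, p, l, \<gamma>) \<Rightarrow> k)"

definition p_opt :: "(real \<Rightarrow> real) \<Rightarrow> (real \<Rightarrow> real) \<Rightarrow> real \<Rightarrow> real" where
  "p_opt a b x = (case sdp_solution a b x of (k, p, l, \<gamma>) \<Rightarrow> p)"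

definition closed_loop_solution ::
  "(real \<Rightarrow> real) \<Rightarrow> (real \<Rightarrow> real) \<Rightarrow> (nat \<Rightarrow> real) \<Rightarrow> bool" where
  "closed_loop_solution a b x \<longleftrightarrow>
     (\<forall>t. x (Suc t) = (a (x t) + b (x t) * k_opt a b (x t)) * x t)"

definition converges_geometrically :: "(nat \<Rightarrow> real) \<Rightarrow> bool" where
  "converges_geometrically x \<longleftrightarrow>
     (\<exists>C \<rho>. C > 0 \<and> 0 \<le> \<rho> \<and> \<rho> < 1 \<and> (\<forall>t. \<bar>x t\<bar> \<le> C * \<rho> ^ t * \<bar>x 0\<bar>))"

primrec p_tilde ::
  "(real \<Rightarrow> real) \<Rightarrow> (real \<Rightarrow> real) \<Rightarrow> (nat \<Rightarrow> real) \<Rightarrow> nat \<Rightarrow> real" where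
  "p_tilde a b x 0 = p_opt a b (x 0)"
| "p_tilde a b x (Suc t) = max (p_opt a b (x (Suc t))) (p_tilde a b x t)"

text \<open>
  The weight at time \<open>t\<close> depends on the trajectory \<open>x\<close> up to time \<open>t\<close>; the last
  argument \<open>y\<close> is the state at which the function is evaluated.
\<close>

definition lyap ::
  "(real \<Rightarrow> real) \<Rightarrow> (real \<Rightarrow> real) \<Rightarrow> (nat \<Rightarrow> real) \<Rightarrow> nat \<Rightarrow> real \<Rightarrow> real" where
  "lyap a b x t y = inverse (p_tilde a b x t) * y\<^sup>2"

end

theory Submission
  imports Defs
begin

text \<open>
  The gain \<open>k = - a x / b x\<close> with \<open>p = 1\<close> is feasible at cost \<open>1 + (a x / b x)\<^sup>2\<close>.
  Since \<open>l \<ge> p * k\<^sup>2 \<ge> 0\<close>, the optimal \<open>p\<close> is at most the optimal cost, hence at most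
  \<open>gamma_bar\<close> whenever \<open>x \<in> X\<close>. The first constraint says that the closed-loop
  factor \<open>s = a x + b x * k\<close> satisfies \<open>s\<^sup>2 \<le> 1 - 1 / p\<close>, so on \<open>X\<close> each step of the loop
  contracts \<open>x\<^sup>2\<close> by the uniform factor \<open>1 - 1 / gamma_bar\<close>
  (\<open>optimal_feedback_contracts\<close>). In particular \<open>\<bar>x t\<bar>\<close> never grows, the trajectory stays in
  the initial ball, which lies in \<open>X\<close>, and the contraction can be iterated. As the weights
  \<open>p_tilde\<close> are nondecreasing in time, dividing by them preserves the inequality.

  What remains is that the optimal solution exists and is unique, as otherwise \<open>k_opt\<close> and
  \<open>p_opt\<close> would be meaningless. Eliminating \<open>p\<close> and \<open>l\<close>, the cost is the quotient of
  \<open>1 + k\<^sup>2\<close> by \<open>1 - s\<^sup>2\<close>, to be minimized over \<open>\<bar>s\<bar> < 1\<close>. A level \<open>c\<close> is its minimum if the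
  quadratic \<open>1 + k\<^sup>2 - c * (1 - s\<^sup>2)\<close> in \<open>s\<close> is nonnegative with a double root in the open
  interval from \<open>- 1\<close> to \<open>1\<close>. The larger of the two levels with vanishing discriminant has this
  property, and completing the square (\<open>cost_complete_square\<close>) shows that the double root is the
  only minimizer. The existence and the uniqueness of the optimum thus come from one identity.
\<close>

section \<open>Existence and uniqueness of the optimal solution\<close>

text \<open>
  The number \<open>u\<close> encodes the optimal cost \<open>c\<close> by \<open>u = 1 + c * b\<^sup>2\<close>. The equation is the
  vanishing of the discriminant of \<open>b\<^sup>2 + (s - a)\<^sup>2 - c * b\<^sup>2 * (1 - s\<^sup>2)\<close> as a polynomial in \<open>s\<close>,
  written so that the signs of the factors can be read off: they agree, and as the larger root
  lies above the mean of \<open>1\<close> and \<open>a\<^sup>2\<close>, they are positive.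
\<close>

lemma double_root_level_exists:
  fixes a b :: real
  assumes "b \<noteq> 0"
  obtains u where "u > 1" "u > a\<^sup>2" "(u - 1) * (u - a\<^sup>2) = b\<^sup>2 * u"
proof -
  define m where "m = 1 + a\<^sup>2 + b\<^sup>2"
  define r where "r = sqrt (m\<^sup>2 - 4 * a\<^sup>2)"
  define u where "u = (m + r) / 2"
  have b2: "b\<^sup>2 > 0" using assms by simp
  have "2 * \<bar>a\<bar> \<le> 1 + a\<^sup>2"
    using sum_squares_bound[of 1 "\<bar>a\<bar>"] by (simp add: power2_eq_square)
  then have "(2 * \<bar>a\<bar>)\<^sup>2 \<le> m\<^sup>2"
    using b2 by (intro power_mono) (simp_all add: m_def add_increasing2)
  then have disc: "m\<^sup>2 - 4 * a\<^sup>2 \<ge> 0" by (simp add: power_mult_distrib)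
  then have r: "r\<^sup>2 = m\<^sup>2 - 4 * a\<^sup>2" "r \<ge> 0" by (simp_all add: r_def)
  have u: "u * u = m * u - a\<^sup>2"
    using r(1) by (simp add: u_def power2_eq_square field_simps)
  then have eq: "(u - 1) * (u - a\<^sup>2) = b\<^sup>2 * u"
    by (simp add: m_def algebra_simps)
  have "m > 1 + a\<^sup>2" using assms by (simp add: m_def)
  moreover have "2 * u = m + r" by (simp add: u_def)
  ultimately have mean: "2 * u > 1 + a\<^sup>2" using r(2) by linarith
  then have "u > 0" using zero_le_power2[of a] by linarith
  then have "(u - 1) * (u - a\<^sup>2) > 0" using eq b2 by simp
  then have "u > 1 \<and> u > a\<^sup>2" using mean by (auto simp: zero_less_mult_iff)
  then show thesis using that eq by blast
qed

lemma cost_complete_square: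
  fixes a b k u :: real
  assumes "u \<noteq> 0" "(u - 1) * (u - a\<^sup>2) = b\<^sup>2 * u"
  shows "b\<^sup>2 * (1 + k\<^sup>2)
    = (u - 1) * (1 - (a + b * k)\<^sup>2) + u * (a + b * k - a / u)\<^sup>2"
proof -
  have "a\<^sup>2 / u = 1 + a\<^sup>2 + b\<^sup>2 - u"
    using assms by (simp add: field_simps power2_eq_square)
  moreover have "u * (a + b * k - a / u)\<^sup>2
      = u * (a + b * k)\<^sup>2 - 2 * a * (a + b * k) + a\<^sup>2 / u"
    using assms(1) by (simp add: field_simps power2_eq_square)
  ultimately show ?thesis
    by (simp only:) (simp add: algebra_simps power2_eq_square)
qed

text \<open>
  Rewriting the cost through the completed square bounds it below by the level \<open>(u - 1) / b\<^sup>2\<close>,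
  with an excess that vanishes only at the double root.
\<close>

lemma feasible_cost_lower_bound:
  assumes "b x \<noteq> 0" "u > 1" "(u - 1) * (u - (a x)\<^sup>2) = (b x)\<^sup>2 * u"
    and feas: "sdp_feasible a b x (k, p, l, g)"
  shows "(b x)\<^sup>2 * g \<ge> (u - 1) + p * u * (a x + b x * k - a x / u)\<^sup>2"
proof -
  let ?s = "a x + b x * k"
  have "p * (1 - ?s\<^sup>2) \<ge> 1" using feas by (simp add: sdp_feasible_def algebra_simps)
  then have 1: "(u - 1) * 1 \<le> (u - 1) * (p * (1 - ?s\<^sup>2))"
    using assms(2) by (intro mult_left_mono) auto
  have "p * (1 + k\<^sup>2) \<le> g" using feas by (simp add: sdp_feasible_def algebra_simps)
  then have 2: "(b x)\<^sup>2 * (p * (1 + k\<^sup>2)) \<le> (b x)\<^sup>2 * g" by (intro mult_left_mono) auto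
  let ?e = "p * u * (?s - a x / u)\<^sup>2"
  have "(u - 1) + ?e \<le> (u - 1) * (p * (1 - ?s\<^sup>2)) + ?e" using 1 by simp
  also have "\<dots> = p * ((u - 1) * (1 - ?s\<^sup>2) + u * (?s - a x / u)\<^sup>2)"
    by (simp only: distrib_left mult_ac)
  also have "\<dots> = p * ((b x)\<^sup>2 * (1 + k\<^sup>2))"
    using cost_complete_square[of u "a x" "b x" k] assms(2,3) by simp
  also have "\<dots> = (b x)\<^sup>2 * (p * (1 + k\<^sup>2))" by (simp only: mult.left_commute)
  also note 2
  finally show ?thesis .
qed

lemma sdp_unique_optimum:
  assumes b: "b x \<noteq> 0"
  shows "\<exists>!z. sdp_optimal a b x z"
proof -
  obtain u where u: "u > 1" "u > (a x)\<^sup>2" "(u - 1) * (u - (a x)\<^sup>2) = (b x)\<^sup>2 * u"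
    using double_root_level_exists[OF b] by blast
  define s where "s = a x / u"
  define k where "k = (s - a x) / b x"
  define p where "p = 1 / (1 - s\<^sup>2)"
  define g where "g = (u - 1) / (b x)\<^sup>2"
  have b2: "(b x)\<^sup>2 > 0" using b by simp
  have sk: "a x + b x * k = s" using b by (simp add: k_def)
  have "(a x)\<^sup>2 < u * u" using u(1,2) mult_strict_mono[of 1 u "(a x)\<^sup>2" u] by auto
  then have s1: "s\<^sup>2 < 1" using u(1) by (simp add: s_def power_divide power2_eq_square)
  then have p: "p * (1 - s\<^sup>2) = 1" "p \<ge> 1" by (simp_all add: p_def field_simps)
  \<comment> \<open>At the double root the completed square vanishes and the lower bound is attained.\<close>
  have "(b x)\<^sup>2 * (1 + k\<^sup>2) = (u - 1) * (1 - s\<^sup>2)"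
    using cost_complete_square[of u "a x" "b x" k] u(1,3) sk by (simp add: s_def)
  then have "(b x)\<^sup>2 * (p * (1 + k\<^sup>2)) = (u - 1) * (p * (1 - s\<^sup>2))"
    by (simp only: mult.left_commute)
  then have g: "p * (1 + k\<^sup>2) = g" using p(1) b2 by (simp add: g_def field_simps)
  let ?z = "(k, p, p * k\<^sup>2, g)"
  have feas: "sdp_feasible a b x ?z"
    using p g sk by (simp add: sdp_feasible_def algebra_simps)
  have bound: "g \<le> g'" and
    eq: "g' \<le> g \<Longrightarrow> (k', p', l', g') = ?z"
    if f: "sdp_feasible a b x (k', p', l', g')" for k' p' l' g'
  proof -
    let ?e = "p' * u * (a x + b x * k' - s)\<^sup>2"
    have p': "p' \<ge> 1" using f by (simp add: sdp_feasible_def)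
    have lb: "(b x)\<^sup>2 * g + ?e \<le> (b x)\<^sup>2 * g'"
      using feasible_cost_lower_bound[of b x u a k' p' l' g'] f b u by (simp add: g_def s_def)
    have e0: "?e \<ge> 0" using p' u(1) by simp
    have "(b x)\<^sup>2 * g \<le> (b x)\<^sup>2 * g'" using lb e0 by linarith
    then show "g \<le> g'" using b2 by simp
    show "(k', p', l', g') = ?z" if le: "g' \<le> g"
    proof -
      have gg: "g' = g" using le \<open>g \<le> g'\<close> by simp
      then have "?e = 0" using lb e0 by simp
      then have "a x + b x * k' = s" using p' u(1) by simp
      then have k': "k' = k" using b by (simp add: k_def field_simps)
      have "p' * (1 - s\<^sup>2) \<ge> 1"
        using f k' sk by (simp add: sdp_feasible_def algebra_simps)
      then have pp: "p \<le> p'" using s1 by (simp add: p_def field_simps)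
      have l': "l' \<ge> p' * k\<^sup>2" "p' + l' \<le> g"
        using f gg k' by (simp_all add: sdp_feasible_def)
      then have "p' * (1 + k\<^sup>2) \<le> p * (1 + k\<^sup>2)" using g by (simp add: algebra_simps)
      moreover have pos: "1 + k\<^sup>2 > 0" using zero_le_power2[of k] by linarith
      ultimately have "p' = p" using pp by (simp add: mult_le_cancel_right)
      moreover have "l' = p * k\<^sup>2" using l' g \<open>p' = p\<close> by (simp add: algebra_simps)
      ultimately show ?thesis using k' gg by simp
    qed
  qed
  show ?thesis
  proof
    show "sdp_optimal a b x ?z"
      using feas bound by (force simp: sdp_optimal_def is_arg_min_def)
  next
    fix z
    assume opt: "sdp_optimal a b x z"
    obtain k' p' l' g' where z: "z = (k', p', l', g')" by (cases z)
    have "sdp_feasible a b x (k', p', l', g')" "g' \<le> g"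
      using opt feas by (force simp: sdp_optimal_def is_arg_min_def z)+
    then show "z = ?z" unfolding z by (rule eq)
  qed
qed

section \<open>Contraction along the closed loop\<close>

text \<open>
  Comparing the optimum with the gain \<open>- a x / b x\<close>, which sends the state to the origin in one
  step, bounds the optimal \<open>p\<close>; feasibility turns this bound into a contraction factor.
\<close>

lemma optimal_feedback_contracts:
  assumes b: "b x \<noteq> 0"
  shows "p_opt a b x \<ge> 1"
    and "(a x + b x * k_opt a b x)\<^sup>2 \<le> 1 - inverse (1 + (a x / b x)\<^sup>2)"
proof -
  obtain k p l g where sol: "sdp_solution a b x = (k, p, l, g)"
    by (cases "sdp_solution a b x")
  have opt: "sdp_optimal a b x (k, p, l, g)"
    using theI'[OF sdp_unique_optimum[of b x a, OF b]] by (simp add: sdp_solution_def[symmetric] sol)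
  then have f: "sdp_feasible a b x (k, p, l, g)"
    by (simp add: sdp_optimal_def is_arg_min_def)
  have k: "k_opt a b x = k" and p: "p_opt a b x = p"
    by (simp_all add: k_opt_def p_opt_def sol)
  let ?q = "(a x / b x)\<^sup>2"
  have "sdp_feasible a b x (- a x / b x, 1, ?q, 1 + ?q)"
    using b by (simp add: sdp_feasible_def)
  then have "g \<le> 1 + ?q"
    using opt by (force simp: sdp_optimal_def is_arg_min_def)
  moreover have p1: "p \<ge> 1" and pl: "l \<ge> p * k\<^sup>2" "p + l \<le> g"
    using f by (simp_all add: sdp_feasible_def)
  moreover have "p * k\<^sup>2 \<ge> 0" using p1 by simp
  ultimately have "p \<le> 1 + ?q" by linarith
  then have inv: "inverse (1 + ?q) \<le> inverse p" using p1 by (intro le_imp_inverse_le) auto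
  have "(a x + b x * k)\<^sup>2 \<le> 1 - inverse p"
    using f p1 by (simp add: sdp_feasible_def field_simps)
  then show "(a x + b x * k_opt a b x)\<^sup>2 \<le> 1 - inverse (1 + ?q)"
    using inv k by simp
  show "p_opt a b x \<ge> 1" using p1 p by simp
qed

lemma geometric_square_decay_imp_converges:
  fixes x :: "nat \<Rightarrow> real"
  assumes "0 \<le> q" "q < 1" and decay: "\<And>t. (x t)\<^sup>2 \<le> q ^ t * (x 0)\<^sup>2"
  shows "converges_geometrically x"
proof -
  have "\<bar>x t\<bar> \<le> sqrt q ^ t * \<bar>x 0\<bar>" for t
    using real_sqrt_le_mono[OF decay[of t]]
    by (simp only: real_sqrt_mult real_sqrt_abs real_sqrt_power[of q])
  then show ?thesis unfolding converges_geometrically_def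
    using assms by (intro exI[of _ 1] exI[of _ "sqrt q"]) auto
qed

theorem theorem1:
  fixes a b :: "real \<Rightarrow> real" and X :: "real set"
    and b_low L gamma_bar r_bar \<delta> :: real
    and x :: "nat \<Rightarrow> real"
  assumes "continuous_on UNIV a" and "continuous_on UNIV b"
    and "compact X" and "0 \<in> X"
    and "b_low > 0" and "\<And>y. y \<in> X \<Longrightarrow> \<bar>b y\<bar> \<ge> b_low"
    and "L > 0" and "\<And>y. y \<in> X \<Longrightarrow> \<bar>a y\<bar> \<le> L"
    and "gamma_bar = 1 + L\<^sup>2 / b_low\<^sup>2"
    and "r_bar > 0" and "cball 0 r_bar \<subseteq> X"
    and "\<And>r. r > 0 \<Longrightarrow> cball 0 r \<subseteq> X \<Longrightarrow> r \<le> r_bar"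
    and "\<delta> = gamma_bar powr (- 1 / 2) * r_bar"
    and "closed_loop_solution a b x"
    and "x 0 \<in> cball 0 \<delta>"
  shows "converges_geometrically x \<and>
    (\<forall>t. lyap a b x t (x t) \<le> (1 - inverse gamma_bar) ^ t * lyap a b x 0 (x 0))"
proof -
  define q where "q = 1 - inverse gamma_bar"
  have gb: "gamma_bar \<ge> 1" using assms(9) by simp
  then have q: "0 \<le> q" "q < 1" by (auto simp: q_def inverse_le_1_iff)
  have "gamma_bar powr (- 1 / 2) \<le> 1 * 1"
    using powr_mono[of "- 1 / 2" 0 gamma_bar] gb by simp
  then have "\<delta> \<le> r_bar" using assms(10,13) mult_right_mono[of _ 1 r_bar] by simp
  have x0: "\<bar>x 0\<bar> \<le> r_bar" using assms(15) \<open>\<delta> \<le> r_bar\<close> by simp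
  have in_X: "y \<in> X" if "y\<^sup>2 \<le> (x 0)\<^sup>2" for y
  proof -
    have "\<bar>y\<bar> \<le> r_bar" using that x0 by (simp add: abs_le_square_iff[symmetric])
    then show ?thesis using assms(11) by auto
  qed
  have b_nz: "b y \<noteq> 0" if "y \<in> X" for y using assms(5) assms(6)[OF that] by auto
  have contract: "(a y + b y * k_opt a b y)\<^sup>2 \<le> q" if y: "y \<in> X" for y
  proof -
    have "\<bar>a y / b y\<bar> \<le> L / b_low"
      unfolding abs_divide using assms(5,7) assms(6)[OF y] assms(8)[OF y]
      by (intro frac_le) auto
    then have "\<bar>a y / b y\<bar>\<^sup>2 \<le> (L / b_low)\<^sup>2" by (intro power_mono) auto
    then have "1 + (a y / b y)\<^sup>2 \<le> gamma_bar" by (simp add: assms(9) power_divide)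
    then have "inverse gamma_bar \<le> inverse (1 + (a y / b y)\<^sup>2)"
      by (intro le_imp_inverse_le) (auto intro: add_pos_nonneg)
    then show ?thesis using optimal_feedback_contracts(2)[of b y a, OF b_nz[OF y]] by (simp add: q_def)
  qed
  have step: "(x (Suc t))\<^sup>2 \<le> q * (x t)\<^sup>2" if "x t \<in> X" for t
  proof -
    have "x (Suc t) = (a (x t) + b (x t) * k_opt a b (x t)) * x t"
      using assms(14) by (simp add: closed_loop_solution_def)
    then show ?thesis using contract[OF that]
      by (simp add: power_mult_distrib mult_right_mono)
  qed
  have decay: "(x t)\<^sup>2 \<le> q ^ t * (x 0)\<^sup>2" and mem: "x t \<in> X" for t
  proof -
    have "(x t)\<^sup>2 \<le> q ^ t * (x 0)\<^sup>2 \<and> x t \<in> X"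
    proof (induction t)
      case 0
      then show ?case using in_X by simp
    next
      case (Suc t)
      have "(x (Suc t))\<^sup>2 \<le> q * (x t)\<^sup>2" using step Suc by simp
      also have "\<dots> \<le> q * (q ^ t * (x 0)\<^sup>2)" using Suc q by (intro mult_left_mono) auto
      finally have *: "(x (Suc t))\<^sup>2 \<le> q ^ Suc t * (x 0)\<^sup>2" by (simp add: mult.assoc)
      have "q ^ Suc t * (x 0)\<^sup>2 \<le> 1 * (x 0)\<^sup>2"
        using q by (intro mult_right_mono power_le_one) auto
      then have "(x (Suc t))\<^sup>2 \<le> (x 0)\<^sup>2" using * by linarith
      then show ?case using * in_X by simp
    qed
    then show "(x t)\<^sup>2 \<le> q ^ t * (x 0)\<^sup>2" "x t \<in> X" by auto
  qed
  have weight_pos: "p_tilde a b x t > 0" for t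
  proof (induction t)
    case 0
    then show ?case using optimal_feedback_contracts(1)[of b "x 0" a, OF b_nz[OF mem]] by simp
  next
    case (Suc t)
    then show ?case by (simp add: less_max_iff_disj)
  qed
  have weight_mono: "p_tilde a b x 0 \<le> p_tilde a b x t" for t
    by (induction t) (auto simp: le_max_iff_disj)
  have "lyap a b x t (x t) \<le> q ^ t * lyap a b x 0 (x 0)" for t
  proof -
    have "inverse (p_tilde a b x t) * (x t)\<^sup>2
        \<le> inverse (p_tilde a b x 0) * (q ^ t * (x 0)\<^sup>2)"
      using weight_pos[of 0] weight_mono[of t] decay[of t]
      by (intro mult_mono le_imp_inverse_le) auto
    then show ?thesis unfolding lyap_def by (simp only: mult.left_commute)
  qed
  then show ?thesis
    using geometric_square_decay_imp_converges[OF q decay] by (simp add: q_def)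
qed

end
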